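(* Let $N=2$, let $W$ be any symmetric doubly stochastic $2\times 2$ matrix with $W_{12}=W_{21}>0$ and $0<\mu(W)<1$, let $L=1$, $\alpha=1/(2L)$, $R\ge0$, and let $d\ge1$. For the algorithm D--NC with constant step-size $\alpha$, for every $k\ge10$ and every $M>0$, $$\mathcal{E}(k;R;\alpha=1/(2L))=\sup_{\{f_1,f_2\}\in\overline{\mathcal{F}}(L=1)}\ \sup_{\overline{x}(0):\ \|\overline{x}(0)-x^\star\|\le R}\ \max_{i=1,2}\left(f(x_i(k))-f^\star\right)\ge M ,$$ that is, $\mathcal{E}(k;R;\alpha=1/(2L))=+\infty$ for all $k\ge10$ and all $R\ge0$.
   Context: $\overline{\mathcal{F}}(L)$ is the collection of all pairs $\{f_1,f_2\}$ of convex functions $f_i:\mathbb{R}^d\to\mathbb{R}$, each differentiable with Lipschitz continuous gradient with constant $L$, such that $f=f_1+f_2$ attains its infimum $f^\star$ at some point $x^\star\in\mathbb{R}^d$ (no bound on the gradients is required). $J=\frac12\mathbf{1}\mathbf{1}^\top$, and $\mu(W)=\|W-J\|$ (spectral norm) is the second largest singular value of $W$. Algorithm D--NC: nodes $i=1,2$ hold $x_i(k),y_i(k)\in\mathbb{R}^d$; stack $x(k)=(x_1(k)^\top,x_2(k)^\top)^\top$, $y(k)=(y_1(k)^\top,y_2(k)^\top)^\top$, and let $\nabla F(y)=(\nabla f_1(y_1)^\top,\nabla f_2(y_2)^\top)^\top$. All nodes start from a common point: $x_1(0)=y_1(0)=x_2(0)=y_2(0)=\overline{x}(0)$. For $k=1,2,\dots$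 $$x(k)=(W\otimes I)^{\tau_x(k)}\left[y(k-1)-\alpha\nabla F(y(k-1))\right],$$ $$y(k)=(W\otimes I)^{\tau_y(k)}\left[x(k)+\beta_{k-1}(x(k)-x(k-1))\right],$$ where $I$ is the $d\times d$ identity, $\beta_k=\frac{k}{k+3}$, and $$\tau_x(k)=\left\lceil\frac{2\log k}{-\log\mu(W)}\right\rceil,\qquad \tau_y(k)=\left\lceil\frac{\log 3}{-\log\mu(W)}+\frac{2\log k}{-\log\mu(W)}\right\rceil .$$ *)

theory Defs
  imports "HOL-Analysis.Analysis"
begin

subsection \<open>Weight matrices\<close>

definition doubly_stochastic :: "real^'n^'n \<Rightarrow> bool" where
  "doubly_stochastic W \<longleftrightarrow>
     (\<forall>i j. 0 \<le> W $ i $ j) \<and>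
     (\<forall>i. (\<Sum>j\<in>UNIV. W $ i $ j) = 1) \<and>
     (\<forall>j. (\<Sum>i\<in>UNIV. W $ i $ j) = 1)"

definition J :: "real^2^2" where
  "J = (\<chi> i j. 1 / 2)"

text \<open>The spectral norm is the operator norm induced by the Euclidean norm; the \<open>norm\<close> of
  type \<open>real^2^2\<close> would be the Frobenius norm.\<close>

definition \<mu> :: "real^2^2 \<Rightarrow> real" where
  "\<mu> W = onorm (\<lambda>v. (W - J) *v v)"

text \<open>Matrix powers with respect to \<open>**\<close>: the operator \<open>^\<close> is not available
  for this product, as \<open>*\<close> on vectors is componentwise.\<close>

primrec mat_pow :: "real^'n^'n \<Rightarrow> nat \<Rightarrow> real^'n^'n" where
  "mat_pow A 0 = mat 1"
| "mat_pow A (Suc n) = A ** mat_pow A n"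

definition kronecker :: "real^'n^'m \<Rightarrow> real^'q^'p \<Rightarrow> real^('n \<times> 'q)^('m \<times> 'p)" where
  "kronecker A B = (\<chi> r c. A $ fst r $ fst c * B $ snd r $ snd c)"

subsection \<open>The function class\<close>

text \<open>\<open>GDERIV f x :> g\<close> determines \<open>g\<close> uniquely; the value is only meaningful where \<open>f\<close> is
  differentiable.\<close>

definition gradient :: "('a::real_inner \<Rightarrow> real) \<Rightarrow> 'a \<Rightarrow> 'a" where
  "gradient f x = (THE g. GDERIV f x :> g)"

text \<open>A pair \<open>{f\<^sub>1, f\<^sub>2}\<close> is a family indexed by the two-element type \<open>2\<close>, whose elements
  are \<open>1\<close> and \<open>2\<close>.\<close>

type_synonym 'd objectives = "2 \<Rightarrow> real^'d \<Rightarrow> real"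

definition total :: "('d::finite) objectives \<Rightarrow> real^'d \<Rightarrow> real" where
  "total f x = f 1 x + f 2 x"

definition minimizers :: "('d::finite) objectives \<Rightarrow> (real^'d) set" where
  "minimizers f = {x. \<forall>z. total f x \<le> total f z}"

definition optimal_value :: "('d::finite) objectives \<Rightarrow> real" where
  "optimal_value f = (INF x. total f x)"

definition Fbar :: "real \<Rightarrow> ('d::finite) objectives set" where
  "Fbar L = {f.
     (\<forall>i. convex_on UNIV (f i) \<and> (\<forall>x. f i differentiable (at x)) \<and>
          L-lipschitz_on UNIV (gradient (f i))) \<and>
     minimizers f \<noteq> {}}"

subsection \<open>Algorithm D--NC\<close>

text \<open>Vectors in \<open>\<real>\<^sup>2\<^sup>d\<close> stacked from two node vectors are indexed by pairs
  (node, coordinate).\<close>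

definition stack :: "(2 \<Rightarrow> real^'d) \<Rightarrow> real^(2 \<times> 'd)" where
  "stack v = (\<chi> p. v (fst p) $ snd p)"

definition node :: "2 \<Rightarrow> real^(2 \<times> 'd) \<Rightarrow> real^'d" where
  "node i z = (\<chi> a. z $ (i, a))"

definition grad_F :: "('d::finite) objectives \<Rightarrow> real^(2 \<times> 'd) \<Rightarrow> real^(2 \<times> 'd)" where
  "grad_F f y = stack (\<lambda>i. gradient (f i) (node i y))"

definition \<beta> :: "nat \<Rightarrow> real" where
  "\<beta> k = real k / (real k + 3)"

text \<open>For \<open>0 < \<mu> W < 1\<close> and \<open>k \<ge> 1\<close> the rounded quantities are nonnegative, so \<open>nat\<close> does
  not truncate.\<close>

definition \<tau>x :: "real^2^2 \<Rightarrow> nat \<Rightarrow> nat" where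
  "\<tau>x W k = nat \<lceil>2 * ln (real k) / (- ln (\<mu> W))\<rceil>"

definition \<tau>y :: "real^2^2 \<Rightarrow> nat \<Rightarrow> nat" where
  "\<tau>y W k = nat \<lceil>ln 3 / (- ln (\<mu> W)) + 2 * ln (real k) / (- ln (\<mu> W))\<rceil>"

primrec dnc :: "real^2^2 \<Rightarrow> real \<Rightarrow> ('d::finite) objectives \<Rightarrow> real^'d \<Rightarrow> nat
    \<Rightarrow> (real^(2 \<times> 'd)) \<times> (real^(2 \<times> 'd))" where
  "dnc W \<alpha> f x0 0 = (stack (\<lambda>i. x0), stack (\<lambda>i. x0))"
| "dnc W \<alpha> f x0 (Suc k) =
     (let x = fst (dnc W \<alpha> f x0 k);
          y = snd (dnc W \<alpha> f x0 k);
          WI = kronecker W (mat 1 :: real^'d^'d);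
          x' = mat_pow WI (\<tau>x W (Suc k)) *v (y - \<alpha> *\<^sub>R grad_F f y);
          y' = mat_pow WI (\<tau>y W (Suc k)) *v (x' + \<beta> k *\<^sub>R (x' - x))
      in (x', y'))"

definition dnc_x :: "real^2^2 \<Rightarrow> real \<Rightarrow> ('d::finite) objectives \<Rightarrow> real^'d \<Rightarrow> 2 \<Rightarrow> nat
    \<Rightarrow> real^'d" where
  "dnc_x W \<alpha> f x0 i k = node i (fst (dnc W \<alpha> f x0 k))"

text \<open>The worst-case error, as an extended real. The class \<open>\<F>\<close> is a parameter so that its type
  fixes the dimension \<open>d\<close>. Where the minimizer of \<open>f\<close> is not unique, \<open>x\<^sup>\<star>\<close> may be any of them.\<close>

definition worst_case_error ::
    "real^2^2 \<Rightarrow> ('d::finite) objectives set \<Rightarrow> nat \<Rightarrow> real \<Rightarrow> real \<Rightarrow> ereal" where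
  "worst_case_error W \<F> k R \<alpha> =
     (SUP f\<in>\<F>. SUP x0\<in>{x0. \<exists>xs\<in>minimizers f. norm (x0 - xs) \<le> R}.
        ereal (MAX i\<in>{1, 2}. total f (dnc_x W \<alpha> f x0 i k) - optimal_value f))"

end

(* Tilting a common quadratic by opposite linear terms, f_i(x) = |x|^2/2 \<plusminus> c \<bullet> x, leaves
   f_1 + f_2 = |x|^2 independent of c. Started at the minimizer 0, the two nodes stay opposite
   to each other and on the line spanned by c, so x_1(k) = p_k c with a number p_k that depends
   on W only. Consensus damps y_k strongly enough that the gradient term cannot be cancelled,
   whence p_k \<noteq> 0, and the error p_k^2 |c|^2 grows without bound in c. *)
theory Submission
  imports Defs
begin

section \<open>The tilted pair as a member of the function class\<close>

lemma gradient_eq: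
  assumes "GDERIV f x :> g"
  shows "gradient f x = g"
  unfolding gradient_def
proof (rule the_equality)
  show "GDERIV f x :> g" by (rule assms)
next
  fix h assume "GDERIV f x :> h"
  then have "(\<lambda>v. inner v h) = (\<lambda>v. inner v g)"
    using assms unfolding gderiv_def by (rule has_derivative_unique)
  \<comment> \<open>Testing both functionals on the vector \<open>h - g\<close> itself forces its
    squared norm to vanish.\<close>
  then have "inner (h - g) h = inner (h - g) g" by metis
  then have "inner (h - g) (h - g) = 0" by (simp add: inner_diff_right)
  then show "h = g" by simp
qed

text \<open>These are the entries of (1, -1), which serve both as the signs of the tilts and as the
  direction of disagreement between the nodes.\<close>

definition node_sign :: "2 \<Rightarrow> real" where
  "node_sign i = (if i = 1 then 1 else - 1)"

lemma node_sign_simps [simp]: "node_sign 1 = 1" "node_sign 2 = - 1"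
  by (simp_all add: node_sign_def)

definition tilted :: "real^'d \<Rightarrow> ('d::finite) objectives" where
  "tilted c i x = inner x x / 2 + node_sign i * inner c x"

lemma total_tilted: "total (tilted c) x = inner x x"
  by (simp add: total_def tilted_def)

lemma GDERIV_tilted: "GDERIV (tilted c i) x :> x + node_sign i *\<^sub>R c"
proof -
  have "((\<lambda>x. inner x x / 2 + node_sign i * inner c x) has_derivative
      (\<lambda>h. (inner x h + inner h x) / 2 + node_sign i * inner c h)) (at x)"
    by (auto intro!: derivative_eq_intros)
  moreover have "(\<lambda>h. (inner x h + inner h x) / 2 + node_sign i * inner c h)
      = (\<lambda>h. inner h (x + node_sign i *\<^sub>R c))"
    by (simp add: inner_add_right inner_commute fun_eq_iff)
  moreover have "tilted c i = (\<lambda>x. inner x x / 2 + node_sign i * inner c x)"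
    by (simp add: tilted_def fun_eq_iff)
  ultimately show ?thesis by (simp add: gderiv_def)
qed

lemma gradient_tilted: "gradient (tilted c i) x = x + node_sign i *\<^sub>R c"
  by (rule gradient_eq[OF GDERIV_tilted])

lemma convex_on_tilted: "convex_on UNIV (tilted c i)"
proof (rule convex_onI)
  fix t :: real and x y :: "real^'a"
  assume t: "0 < t" "t < 1"
  \<comment> \<open>The convexity gap of the squared norm has this closed form; the linear tilt
    contributes no gap.\<close>
  have "(1 - t) * inner x x + t * inner y y
      - inner ((1 - t) *\<^sub>R x + t *\<^sub>R y) ((1 - t) *\<^sub>R x + t *\<^sub>R y)
      = t * (1 - t) * inner (x - y) (x - y)"
    by (simp add: inner_add_left inner_add_right inner_diff_left inner_diff_right
        inner_commute algebra_simps power2_eq_square)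
  moreover have "t * (1 - t) * inner (x - y) (x - y) \<ge> 0"
    using t by simp
  ultimately have "inner ((1 - t) *\<^sub>R x + t *\<^sub>R y) ((1 - t) *\<^sub>R x + t *\<^sub>R y)
      \<le> (1 - t) * inner x x + t * inner y y"
    by linarith
  moreover have "node_sign i * inner c ((1 - t) *\<^sub>R x + t *\<^sub>R y)
      = (1 - t) * (node_sign i * inner c x) + t * (node_sign i * inner c y)"
    by (simp add: inner_add_right algebra_simps)
  ultimately show "tilted c i ((1 - t) *\<^sub>R x + t *\<^sub>R y)
      \<le> (1 - t) * tilted c i x + t * tilted c i y"
    unfolding tilted_def by (simp add: distrib_left)
qed simp

lemma zero_in_minimizers_tilted: "0 \<in> minimizers (tilted c)"
  by (simp add: minimizers_def total_tilted)

lemma optimal_value_tilted: "optimal_value (tilted c) = 0"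
proof -
  have "(INF x. total (tilted c) x) = total (tilted c) 0"
    by (rule cInf_eq_minimum) (auto simp: total_tilted)
  then show ?thesis by (simp add: optimal_value_def total_tilted)
qed

lemma tilted_in_Fbar: "tilted c \<in> Fbar 1"
proof -
  have "tilted c i differentiable (at x)" for i x
    using GDERIV_tilted unfolding gderiv_def by (rule differentiableI)
  \<comment> \<open>Each gradient is a translation, hence an isometry.\<close>
  moreover have "1-lipschitz_on UNIV (gradient (tilted c i))" for i
    by (rule lipschitz_onI) (simp_all add: gradient_tilted dist_norm)
  ultimately show ?thesis
    using zero_in_minimizers_tilted[of c] unfolding Fbar_def by (auto simp: convex_on_tilted)
qed

section \<open>Reduction of the iteration to two scalars\<close>

text \<open>The vectors \<open>(v, - v)\<close>, on which \<open>W \<otimes> I\<close> acts as a scalar.\<close>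

definition antisym_stack :: "real^'d \<Rightarrow> real^(2 \<times> 'd)" where
  "antisym_stack v = stack (\<lambda>i. node_sign i *\<^sub>R v)"

lemma antisym_stack_add: "antisym_stack v + antisym_stack w = antisym_stack (v + w)"
  by (simp add: antisym_stack_def stack_def vec_eq_iff algebra_simps)

lemma antisym_stack_diff: "antisym_stack v - antisym_stack w = antisym_stack (v - w)"
  by (simp add: antisym_stack_def stack_def vec_eq_iff algebra_simps)

lemma antisym_stack_scaleR: "a *\<^sub>R antisym_stack v = antisym_stack (a *\<^sub>R v)"
  by (simp add: antisym_stack_def stack_def vec_eq_iff)

lemma node_antisym_stack: "node i (antisym_stack v) = node_sign i *\<^sub>R v"
  by (simp add: antisym_stack_def stack_def node_def vec_eq_iff)

text \<open>Opposite tilts meet opposite nodes, so the two gradients are opposite as well and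
  gradient steps preserve antisymmetry.\<close>

lemma grad_F_tilted: "grad_F (tilted c) (antisym_stack v) = antisym_stack (v + c)"
  unfolding grad_F_def gradient_tilted node_antisym_stack
  by (simp add: antisym_stack_def scaleR_add_right)

text \<open>The assumptions make (1, -1) an eigenvector of \<open>W\<close> for \<open>l\<close>;
  the identity factor keeps the coordinates of \<open>v\<close> apart.\<close>

lemma kronecker_antisym_stack:
  fixes W :: "real^2^2" and v :: "real^'d"
  assumes "W $ 1 $ 1 - W $ 1 $ 2 = l" and "W $ 2 $ 2 - W $ 2 $ 1 = l"
  shows "kronecker W (mat 1 :: real^'d^'d) *v antisym_stack v = antisym_stack (l *\<^sub>R v)"
proof -
  have entry: "(\<Sum>q\<in>UNIV. kronecker W (mat 1 :: real^'d^'d) $ (i, a) $ q * antisym_stack v $ q)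
      = (\<Sum>j\<in>UNIV. W $ i $ j * node_sign j) * v $ a" for i a
  proof -
    have "(\<Sum>q\<in>UNIV. kronecker W (mat 1 :: real^'d^'d) $ (i, a) $ q * antisym_stack v $ q)
        = (\<Sum>j\<in>UNIV. \<Sum>b\<in>UNIV. if a = b then W $ i $ j * node_sign j * v $ b else 0)"
      unfolding UNIV_Times_UNIV[symmetric] sum.cartesian_product
      by (rule sum.cong)
        (auto simp: kronecker_def antisym_stack_def stack_def mat_def)
    also have "\<dots> = (\<Sum>j\<in>UNIV. W $ i $ j * node_sign j) * v $ a"
      by (simp add: sum_distrib_right)
    finally show ?thesis .
  qed
  have row: "(\<Sum>j\<in>UNIV. W $ i $ j * node_sign j) = node_sign i * l" for i
    using exhaust_2[of i] assms by (auto simp: sum_2)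
  show ?thesis
    by (auto simp: vec_eq_iff matrix_vector_mult_def entry row)
      (simp add: antisym_stack_def stack_def)
qed

lemma mat_pow_eigenvector:
  fixes A :: "real^'n^'n" and g :: "'v::real_vector \<Rightarrow> real^'n"
  assumes "\<And>v. A *v g v = g (l *\<^sub>R v)"
  shows "mat_pow A n *v g v = g (l ^ n *\<^sub>R v)"
proof (induction n)
  case 0
  then show ?case by simp
next
  case (Suc n)
  have "mat_pow A (Suc n) *v g v = A *v (mat_pow A n *v g v)"
    by (simp add: matrix_vector_mul_assoc)
  also have "\<dots> = g (l ^ Suc n *\<^sub>R v)"
    by (simp only: Suc.IH assms scaleR_scaleR power_Suc)
  finally show ?case .
qed

text \<open>The coefficients of \<open>c\<close> in the iterates of node 1 for the tilted pair with \<open>\<alpha> = 1/2\<close>;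
  \<open>l\<close> is the eigenvalue of \<open>W\<close> at \<open>(1, -1)\<close>.\<close>

primrec dnc_coeff :: "real^2^2 \<Rightarrow> real \<Rightarrow> nat \<Rightarrow> real \<times> real" where
  "dnc_coeff W l 0 = (0, 0)"
| "dnc_coeff W l (Suc k) =
     (let p = fst (dnc_coeff W l k);
          q = snd (dnc_coeff W l k);
          p' = l ^ \<tau>x W (Suc k) * ((q - 1) / 2);
          q' = l ^ \<tau>y W (Suc k) * (p' + \<beta> k * (p' - p))
      in (p', q'))"

text \<open>Gradient step, momentum and consensus each keep the iterates antisymmetric and on the
  line of \<open>c\<close>, so only scalar coefficients independent of \<open>c\<close>
  remain.\<close>

lemma dnc_tilted:
  fixes c :: "real^'d"
  assumes "W $ 1 $ 1 - W $ 1 $ 2 = l" and "W $ 2 $ 2 - W $ 2 $ 1 = l"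
  shows "dnc W (1/2) (tilted c) 0 k =
    (antisym_stack (fst (dnc_coeff W l k) *\<^sub>R c), antisym_stack (snd (dnc_coeff W l k) *\<^sub>R c))"
proof (induction k)
  case 0
  then show ?case by (simp add: antisym_stack_def)
next
  case (Suc k)
  have pow: "mat_pow (kronecker W (mat 1 :: real^'d^'d)) n *v antisym_stack v
      = antisym_stack (l ^ n *\<^sub>R v)" for n v
    using kronecker_antisym_stack[OF assms] by (rule mat_pow_eigenvector)
  \<comment> \<open>At \<open>q\<close> times \<open>c\<close> the gradient of node 1 is
    \<open>q + 1\<close> times \<open>c\<close>; half of it is subtracted.\<close>
  have step: "q *\<^sub>R c - (1/2) *\<^sub>R (q *\<^sub>R c + c) = ((q - 1) / 2) *\<^sub>R c" for q
    by (simp add: vec_eq_iff field_simps)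
  have mom: "p *\<^sub>R c + b *\<^sub>R (p *\<^sub>R c - p' *\<^sub>R c) = (p + b * (p - p')) *\<^sub>R c" for p p' b
    by (simp add: algebra_simps)
  show ?case
    unfolding dnc.simps dnc_coeff.simps Let_def Suc.IH fst_conv snd_conv grad_F_tilted
      antisym_stack_scaleR antisym_stack_diff antisym_stack_add step pow scaleR_scaleR mom ..
qed

section \<open>Consensus damping and nonvanishing of the coefficient\<close>

text \<open>The matrix \<open>W - J\<close> has eigenvalues \<open>0\<close> at \<open>(1, 1)\<close> and \<open>l\<close> at \<open>(1, -1)\<close>.\<close>

lemma abs_eigenvalue_le_mu:
  fixes W :: "real^2^2"
  assumes "W $ 1 $ 1 - W $ 1 $ 2 = l" and "W $ 2 $ 2 - W $ 2 $ 1 = l"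
  shows "\<bar>l\<bar> \<le> \<mu> W"
proof -
  define v :: "real^2" where "v = (\<chi> i. node_sign i)"
  have entries: "W $ 1 $ 1 = l + W $ 1 $ 2" "W $ 2 $ 2 = l + W $ 2 $ 1"
    using assms by auto
  have "(W - J) *v v = l *\<^sub>R v"
    by (simp add: vec_eq_iff forall_2 matrix_vector_mult_def sum_2 v_def J_def entries
        algebra_simps)
  moreover have "norm ((W - J) *v v) \<le> \<mu> W * norm v"
    unfolding \<mu>_def by (rule onorm[OF matrix_vector_mul_bounded_linear])
  ultimately have "\<bar>l\<bar> * norm v \<le> \<mu> W * norm v" by simp
  moreover have "norm v > 0"
    by (auto simp: v_def vec_eq_iff forall_2)
  ultimately show ?thesis by simp
qed

lemma power_le_of_le_log:
  fixes m x z :: real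
  assumes "0 < m" "m < 1" "0 < x" "ln x / (- ln m) \<le> z"
  shows "m ^ nat \<lceil>z\<rceil> \<le> 1 / x"
proof -
  have neg: "ln m < 0" using assms by simp
  \<comment> \<open>Rounding up and truncation at 0 can only raise the exponent.\<close>
  have "ln x / (- ln m) \<le> real (nat \<lceil>z\<rceil>)"
    using assms(4) real_nat_ceiling_ge[of z] by linarith
  then have "ln x \<le> real (nat \<lceil>z\<rceil>) * (- ln m)"
    using neg by (subst (asm) pos_divide_le_eq) auto
  then have "ln (m ^ nat \<lceil>z\<rceil>) \<le> ln (1 / x)"
    using assms(1,3) by (simp add: ln_realpow ln_div)
  then show ?thesis
    using assms(1,3) by (subst (asm) ln_le_cancel_iff) auto
qed

text \<open>The two quotients in \<open>\<tau>y\<close> add up to the logarithm of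
  \<open>3 * k^2\<close> to base \<open>1 / \<mu> W\<close>.\<close>

lemma power_tau_y_le:
  assumes "\<bar>l\<bar> \<le> \<mu> W" "0 < \<mu> W" "\<mu> W < 1" "0 < k"
  shows "\<bar>l\<bar> ^ \<tau>y W k \<le> 1 / (3 * (real k)\<^sup>2)"
proof -
  have "ln (3 * (real k)\<^sup>2) = ln 3 + 2 * ln (real k)"
    using assms(4) by (simp add: ln_mult ln_realpow)
  then have "ln (3 * (real k)\<^sup>2) / (- ln (\<mu> W))
      = ln 3 / (- ln (\<mu> W)) + 2 * ln (real k) / (- ln (\<mu> W))"
    by (simp only: add_divide_distrib)
  then have "\<mu> W ^ \<tau>y W k \<le> 1 / (3 * (real k)\<^sup>2)"
    unfolding \<tau>y_def using assms by (intro power_le_of_le_log) auto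
  moreover have "\<bar>l\<bar> ^ \<tau>y W k \<le> \<mu> W ^ \<tau>y W k"
    using assms(1) by (rule power_mono) simp
  ultimately show ?thesis by linarith
qed

text \<open>The three bounds feed each other in the induction. The product form includes k = 0,
  where it is vacuous, so the plain bound on the second coefficient is carried along to start the
  next step.\<close>

lemma dnc_coeff_bounds:
  assumes "\<bar>l\<bar> \<le> \<mu> W" "0 < \<mu> W" "\<mu> W < 1"
  shows "\<bar>fst (dnc_coeff W l k)\<bar> \<le> 1 \<and> (real k)\<^sup>2 * \<bar>snd (dnc_coeff W l k)\<bar> \<le> 1
    \<and> \<bar>snd (dnc_coeff W l k)\<bar> \<le> 1"
proof (induction k)
  case 0
  then show ?case by simp
next
  case (Suc k)
  define p q where "p = fst (dnc_coeff W l k)" and "q = snd (dnc_coeff W l k)"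
  define p' where "p' = l ^ \<tau>x W (Suc k) * ((q - 1) / 2)"
  define q' where "q' = l ^ \<tau>y W (Suc k) * (p' + \<beta> k * (p' - p))"
  have coeff: "dnc_coeff W l (Suc k) = (p', q')"
    by (simp add: Let_def p_def q_def p'_def q'_def)
  have p: "\<bar>p\<bar> \<le> 1" and q: "\<bar>q\<bar> \<le> 1"
    using Suc.IH by (auto simp: p_def q_def)
  have "\<bar>l\<bar> ^ \<tau>x W (Suc k) \<le> 1"
    using assms by (intro power_le_one) auto
  then have "\<bar>l ^ \<tau>x W (Suc k)\<bar> * \<bar>(q - 1) / 2\<bar> \<le> 1 * 1"
    using q by (intro mult_mono) (auto simp: power_abs)
  then have p': "\<bar>p'\<bar> \<le> 1" by (simp add: p'_def abs_mult)
  have "0 \<le> \<beta> k" "\<beta> k \<le> 1" by (simp_all add: \<beta>_def)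
  moreover have "\<bar>p' - p\<bar> \<le> 2" using p p' by linarith
  ultimately have "\<beta> k * \<bar>p' - p\<bar> \<le> 1 * 2" by (intro mult_mono) auto
  then have "\<bar>\<beta> k * (p' - p)\<bar> \<le> 2" using \<open>0 \<le> \<beta> k\<close> by (simp add: abs_mult)
  \<comment> \<open>The 3 = 1 + 2 lost to momentum is exactly what the \<open>ln 3\<close> in
    \<open>\<tau>y\<close> pays for.\<close>
  then have mom: "\<bar>p' + \<beta> k * (p' - p)\<bar> \<le> 3" using p' by linarith
  have "\<bar>l ^ \<tau>y W (Suc k)\<bar> \<le> 1 / (3 * (real (Suc k))\<^sup>2)"
    using power_tau_y_le[OF assms, of "Suc k"] by (simp add: power_abs)
  then have "\<bar>q'\<bar> \<le> 1 / (3 * (real (Suc k))\<^sup>2) * 3"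
    unfolding q'_def abs_mult using mom by (rule mult_mono) auto
  then have q': "\<bar>q'\<bar> \<le> 1 / (real (Suc k))\<^sup>2" by simp
  then have "(real (Suc k))\<^sup>2 * \<bar>q'\<bar> \<le> 1"
    by (simp add: pos_le_divide_eq mult.commute del: of_nat_Suc)
  moreover have "1 / (real (Suc k))\<^sup>2 \<le> 1" by simp
  ultimately show ?case
    unfolding coeff fst_conv snd_conv using p' q' by linarith
qed

text \<open>As \<open>l\<close> is nonzero, the coefficient vanishes only if the preceding
  \<open>q\<close> equals 1, which the inverse-square decay of \<open>q\<close> excludes.\<close>

lemma dnc_coeff_nonzero:
  assumes "\<bar>l\<bar> \<le> \<mu> W" "0 < \<mu> W" "\<mu> W < 1" "l \<noteq> 0" "k \<ge> 3"
  shows "fst (dnc_coeff W l k) \<noteq> 0"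
proof -
  \<comment> \<open>The index drops by one: \<open>j \<ge> 2\<close> bounds the absolute value of
    \<open>q\<close> by 1/4, whereas j = 1 would allow 1.\<close>
  obtain j where j: "k = Suc j" "j \<ge> 2" using assms(5) by (cases k) auto
  define q where "q = snd (dnc_coeff W l j)"
  have "(real j)\<^sup>2 \<ge> 2\<^sup>2" using j(2) by (intro power_mono) auto
  then have "2\<^sup>2 * \<bar>q\<bar> \<le> (real j)\<^sup>2 * \<bar>q\<bar>" by (rule mult_right_mono) simp
  also have "\<dots> \<le> 1" using dnc_coeff_bounds[OF assms(1-3)] by (simp add: q_def)
  finally have "q \<noteq> 1" by auto
  then show ?thesis using assms(4) by (simp add: j(1) Let_def q_def)
qed

section \<open>Unboundedness of the worst-case error\<close>

theorem mainTheorem6: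
  fixes W :: "real^2^2" and L \<alpha> R :: real and k :: nat
  assumes "transpose W = W" and "doubly_stochastic W"
    and "W $ 1 $ 2 = W $ 2 $ 1" and "W $ 2 $ 1 > 0"
    and "0 < \<mu> W" and "\<mu> W < 1"
    and "L = 1" and "\<alpha> = 1 / (2 * L)" and "R \<ge> 0" and "k \<ge> 10"
  shows "(\<forall>M::real. M > 0 \<longrightarrow>
            worst_case_error W (Fbar L :: ('d::finite) objectives set) k R \<alpha> \<ge> ereal M) \<and>
         worst_case_error W (Fbar L :: 'd objectives set) k R \<alpha> = \<infinity>"
proof -
  define l where "l = W $ 1 $ 1 - W $ 1 $ 2"
  have sums: "W $ 1 $ 1 + W $ 1 $ 2 = 1" "W $ 2 $ 1 + W $ 2 $ 2 = 1"
    using assms(2) by (auto simp: doubly_stochastic_def sum_2 forall_2)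
  have l1: "W $ 1 $ 1 - W $ 1 $ 2 = l" and l2: "W $ 2 $ 2 - W $ 2 $ 1 = l"
    using sums assms(3) by (auto simp: l_def)
  have l_le: "\<bar>l\<bar> \<le> \<mu> W" by (rule abs_eigenvalue_le_mu[OF l1 l2])
  \<comment> \<open>A zero eigenvalue would make all entries of \<open>W\<close> equal to 1/2, that
    is \<open>W = J\<close>, against \<open>0 < \<mu> W\<close>.\<close>
  have "l \<noteq> 0"
  proof
    assume "l = 0"
    then have "W - J = 0"
      using l1 l2 sums by (simp add: vec_eq_iff forall_2 J_def)
    then have "(\<lambda>v. (W - J) *v v) = (\<lambda>v. 0)" by (simp add: fun_eq_iff)
    then have "\<mu> W = 0" unfolding \<mu>_def by (simp only: onorm_zero)
    with assms(5) show False by simp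
  qed
  define p where "p = fst (dnc_coeff W l k)"
  have "p \<noteq> 0"
    unfolding p_def using l_le assms(5,6,10) \<open>l \<noteq> 0\<close> by (intro dnc_coeff_nonzero) auto
  have large: "ereal B \<le> worst_case_error W (Fbar L :: 'd objectives set) k R \<alpha>" for B
  proof -
    \<comment> \<open>This size makes the error of node 1, \<open>p^2\<close> times the squared norm
      of \<open>c\<close>, equal to the absolute value of \<open>B\<close>.\<close>
    obtain c :: "real^'d" where c: "norm c = sqrt \<bar>B\<bar> / \<bar>p\<bar>"
      using vector_choose_size[of "sqrt \<bar>B\<bar> / \<bar>p\<bar>"] by auto
    have x1: "dnc_x W \<alpha> (tilted c) 0 1 k = p *\<^sub>R c"
    proof -
      have "\<alpha> = 1/2" using assms(7,8) by simp
      then show ?thesis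
        by (simp only: dnc_x_def dnc_tilted[OF l1 l2] fst_conv node_antisym_stack
            node_sign_simps scaleR_one p_def)
    qed
    have "inner (p *\<^sub>R c) (p *\<^sub>R c) = (\<bar>p\<bar> * norm c)\<^sup>2"
      by (simp add: power2_norm_eq_inner[symmetric] power_mult_distrib)
    also have "\<dots> = \<bar>B\<bar>" using \<open>p \<noteq> 0\<close> by (simp add: c)
    finally have "B \<le> total (tilted c) (dnc_x W \<alpha> (tilted c) 0 1 k) - optimal_value (tilted c)"
      by (simp add: x1 total_tilted optimal_value_tilted)
    also have "\<dots> \<le> (MAX i\<in>{1, 2}. total (tilted c) (dnc_x W \<alpha> (tilted c) 0 i k)
        - optimal_value (tilted c))"
      by (rule Max_ge) auto
    finally have "ereal B \<le> ereal (MAX i\<in>{1, 2}.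
        total (tilted c) (dnc_x W \<alpha> (tilted c) 0 i k) - optimal_value (tilted c))"
      by (simp only: ereal_less_eq)
    \<comment> \<open>The start is itself a minimizer, so even R = 0 admits it.\<close>
    moreover have "(0 :: real^'d) \<in> {x0. \<exists>xs\<in>minimizers (tilted c). norm (x0 - xs) \<le> R}"
      using zero_in_minimizers_tilted[of c] assms(9) by (auto intro!: bexI[of _ 0])
    moreover have "tilted c \<in> Fbar L" using tilted_in_Fbar assms(7) by simp
    ultimately show ?thesis
      unfolding worst_case_error_def by (blast intro: SUP_upper2)
  qed
  then show ?thesis by (auto intro: ereal_top)
qed

end
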